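(* Let $F$ be a Banach lattice such that $F^{*}$ has the dual positive Schur property. Then, for every Banach lattice $E$, the adjoint $T^* \colon F^* \longrightarrow E^*$ of every regular operator $T \colon E \longrightarrow F$ is almost limited, hence $T^{**} \colon E^{**} \longrightarrow F^{**}$ is almost Dunford-Pettis.
   Context: Operators are linear. An operator between Banach lattices is regular if it is the difference of two positive operators. A Banach lattice $G$ has the dual positive Schur property if every positive weak$^*$-null sequence in $G^*$ is norm null. An operator $S$ from a Banach space $Y$ to a Banach lattice $G$ is almost limited if $S^*$ sends disjoint weak$^*$-null sequences in $G^*$ to norm null sequences in $Y^*$. An operator from a Banach lattice to a Banach space is almost Dunford-Pettis if it sends disjoint weakly null sequences to norm null sequences (equivalently, positive disjoint weakly null sequences to norm null sequences). *)

theory Defs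
  imports "HOL-Analysis.Analysis" "HOL-Library.Lattice_Algebras"
begin

section \<open>Banach lattices\<close>

class banach_lattice = banach + ordered_real_vector + lattice_ab_group_add_abs +
  assumes norm_mono_abs: "\<bar>x\<bar> \<le> \<bar>y\<bar> \<Longrightarrow> norm x \<le> norm y"

context
  fixes x y :: "'a::banach_lattice"
begin

lemma norm_mono_nonneg: "0 \<le> x \<Longrightarrow> x \<le> y \<Longrightarrow> norm x \<le> norm y"
  by (rule norm_mono_abs) simp

lemma norm_abs_eq: "norm \<bar>x\<bar> = norm x"
  by (rule order.antisym; rule norm_mono_abs) simp_all

lemma norm_pprt_le: "norm (pprt x) \<le> norm x"
proof -
  have "pprt x \<le> \<bar>x\<bar>"
    unfolding pprt_def by (simp add: abs_ge_self)
  then have "\<bar>pprt x\<bar> \<le> \<bar>x\<bar>"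
    by simp
  then show ?thesis
    by (rule norm_mono_abs)
qed

lemma pprt_minus_pprt: "pprt x - pprt (- x) = x"
  using prts[of x] by (simp add: pprt_neg)

end

text \<open>
  The order dual of a Banach lattice has to be a Banach lattice again, but the scalar type of
  the dual space \<open>'a \<Rightarrow>\<^sub>L real\<close> cannot be singled out in a type class arity.  The instance is
  therefore established for bounded operators into any Dedekind complete Banach lattice whose
  closed unit ball is the order interval between \<open>- u\<close> and \<open>u\<close>, of which \<open>real\<close>
  (with \<open>u = 1\<close>) is an instance.
\<close>

class order_unit_banach_lattice = banach_lattice + conditionally_complete_lattice +
  fixes order_unit :: 'a
  assumes norm_le_order_unit: "0 \<le> r \<Longrightarrow> norm x \<le> r \<longleftrightarrow> \<bar>x\<bar> \<le> r *\<^sub>R order_unit"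

instance real :: banach_lattice
  by standard simp

instantiation real :: order_unit_banach_lattice
begin
definition order_unit_real :: real where "order_unit_real = 1"
instance by standard (simp add: order_unit_real_def)
end

lemma le_norm_order_unit:
  fixes x :: "'a::order_unit_banach_lattice"
  shows "\<bar>x\<bar> \<le> norm x *\<^sub>R order_unit" "x \<le> norm x *\<^sub>R order_unit"
proof -
  show *: "\<bar>x\<bar> \<le> norm x *\<^sub>R order_unit"
    using norm_le_order_unit[of "norm x" x] by simp
  show "x \<le> norm x *\<^sub>R order_unit"
    using * abs_ge_self order_trans by blast
qed

lemma order_unit_nonneg: "0 \<le> (order_unit :: 'a::order_unit_banach_lattice)"
  using norm_le_order_unit[of 1 "0::'a"] by simp

section \<open>The order dual\<close>

definition riesz_sup :: "('a::banach_lattice \<Rightarrow>\<^sub>L 'b::order_unit_banach_lattice) \<Rightarrow> 'a \<Rightarrow> 'b"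
  where "riesz_sup f x = (SUP y\<in>{0..x}. f y)"

definition riesz_pos ::
    "('a::banach_lattice \<Rightarrow>\<^sub>L 'b::order_unit_banach_lattice) \<Rightarrow> ('a \<Rightarrow>\<^sub>L 'b)"
  where "riesz_pos f = Blinfun (\<lambda>x. riesz_sup f (pprt x) - riesz_sup f (pprt (- x)))"

context
  fixes f :: "'a::banach_lattice \<Rightarrow>\<^sub>L 'b::order_unit_banach_lattice"
begin

lemma riesz_bound:
  assumes "0 \<le> y" "y \<le> x"
  shows "f y \<le> (norm f * norm x) *\<^sub>R order_unit"
proof -
  have "norm (f y) \<le> norm f * norm x"
    by (meson assms mult_left_mono norm_blinfun norm_ge_zero norm_mono_nonneg order_trans)
  then have "\<bar>f y\<bar> \<le> (norm f * norm x) *\<^sub>R order_unit"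
    by (subst norm_le_order_unit[symmetric]) auto
  then show ?thesis
    using abs_ge_self order_trans by blast
qed

lemma riesz_bdd: "bdd_above (f ` {0..x})"
  by (rule bdd_aboveI2[where M = "(norm f * norm x) *\<^sub>R order_unit"]) (auto intro: riesz_bound)

lemma riesz_upper: "0 \<le> y \<Longrightarrow> y \<le> x \<Longrightarrow> f y \<le> riesz_sup f x"
  unfolding riesz_sup_def by (rule cSUP_upper[OF _ riesz_bdd]) simp

lemma riesz_least: "0 \<le> x \<Longrightarrow> (\<And>y. 0 \<le> y \<Longrightarrow> y \<le> x \<Longrightarrow> f y \<le> b) \<Longrightarrow> riesz_sup f x \<le> b"
  unfolding riesz_sup_def by (rule cSUP_least) auto

lemma riesz_nonneg: "0 \<le> x \<Longrightarrow> 0 \<le> riesz_sup f x"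
  using riesz_upper[of 0 x] by (simp add: blinfun.zero_right)

lemma riesz_norm: assumes "0 \<le> x" shows "norm (riesz_sup f x) \<le> norm f * norm x"
proof (subst norm_le_order_unit)
  show "\<bar>riesz_sup f x\<bar> \<le> (norm f * norm x) *\<^sub>R order_unit"
    using assms by (simp add: riesz_nonneg riesz_least riesz_bound)
qed simp

lemma riesz_add:
  assumes x: "0 \<le> x" "0 \<le> y"
  shows "riesz_sup f (x + y) = riesz_sup f x + riesz_sup f y"
proof (rule order.antisym)
  show "riesz_sup f (x + y) \<le> riesz_sup f x + riesz_sup f y"
  proof (rule riesz_least)
    fix z assume z: "0 \<le> z" "z \<le> x + y"
    define w where "w = inf z x"
    have w: "0 \<le> w" "w \<le> x" "w \<le> z"
      using z x by (auto simp: w_def)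
    have "z - w = sup 0 (z - x)"
      unfolding w_def by (simp add: diff_inf_eq_sup add_sup_distrib_left)
    also have "\<dots> \<le> y"
      using x z by (simp add: algebra_simps)
    finally have "f (z - w) \<le> riesz_sup f y"
      using w by (intro riesz_upper) auto
    moreover have "f w \<le> riesz_sup f x"
      using w by (intro riesz_upper)
    ultimately show "f z \<le> riesz_sup f x + riesz_sup f y"
      using add_mono[of "f w" _ "f (z - w)"] by (simp add: blinfun.diff_right)
  qed (use x in simp)
  have *: "f a + f b \<le> riesz_sup f (x + y)" if "0 \<le> a" "a \<le> x" "0 \<le> b" "b \<le> y" for a b
    using riesz_upper[of "a + b" "x + y"] that by (simp add: blinfun.add_right add_mono)
  have **: "riesz_sup f x \<le> riesz_sup f (x + y) - f b" if "0 \<le> b" "b \<le> y" for b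
    using * that x by (intro riesz_least) (auto simp: le_diff_eq)
  have "riesz_sup f y \<le> riesz_sup f (x + y) - riesz_sup f x"
    using ** x by (intro riesz_least) (auto simp: le_diff_eq add.commute)
  then show "riesz_sup f x + riesz_sup f y \<le> riesz_sup f (x + y)"
    by (simp add: le_diff_eq add.commute)
qed

lemma riesz_scale_le:
  assumes "0 < r" "0 \<le> x"
  shows "r *\<^sub>R riesz_sup f x \<le> riesz_sup f (r *\<^sub>R x)"
proof -
  have "riesz_sup f x \<le> inverse r *\<^sub>R riesz_sup f (r *\<^sub>R x)"
  proof (rule riesz_least)
    fix y assume "0 \<le> y" "y \<le> x"
    then have "f (r *\<^sub>R y) \<le> riesz_sup f (r *\<^sub>R x)"
      using assms by (intro riesz_upper) (auto intro: scaleR_left_mono scaleR_nonneg_nonneg)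
    then have "inverse r *\<^sub>R f (r *\<^sub>R y) \<le> inverse r *\<^sub>R riesz_sup f (r *\<^sub>R x)"
      using assms by (intro scaleR_left_mono) auto
    then show "f y \<le> inverse r *\<^sub>R riesz_sup f (r *\<^sub>R x)"
      using assms by (simp add: blinfun.scaleR_right)
  qed (rule assms)
  then have "r *\<^sub>R riesz_sup f x \<le> r *\<^sub>R (inverse r *\<^sub>R riesz_sup f (r *\<^sub>R x))"
    using assms by (intro scaleR_left_mono) auto
  then show ?thesis using assms by simp
qed

lemma riesz_scale:
  assumes "0 < r" "0 \<le> x"
  shows "riesz_sup f (r *\<^sub>R x) = r *\<^sub>R riesz_sup f x"
proof (rule order.antisym)
  have "inverse r *\<^sub>R riesz_sup f (r *\<^sub>R x) \<le> riesz_sup f x"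
    using riesz_scale_le[of "inverse r" "r *\<^sub>R x"] assms by (simp add: scaleR_nonneg_nonneg)
  then have "r *\<^sub>R (inverse r *\<^sub>R riesz_sup f (r *\<^sub>R x)) \<le> r *\<^sub>R riesz_sup f x"
    using assms by (intro scaleR_left_mono) auto
  then show "riesz_sup f (r *\<^sub>R x) \<le> r *\<^sub>R riesz_sup f x"
    using assms by simp
qed (rule riesz_scale_le[OF assms])

lemma riesz_diff:
  assumes "0 \<le> a" "0 \<le> b" "x = a - b"
  shows "riesz_sup f (pprt x) - riesz_sup f (pprt (- x)) = riesz_sup f a - riesz_sup f b"
proof -
  have "pprt x + b = pprt (- x) + a"
  proof -
    have "pprt x = pprt (- x) + x"
      using pprt_minus_pprt[of x] by (simp add: diff_eq_eq add.commute)
    moreover have "x + b = a"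
      using assms(3) by simp
    ultimately show ?thesis
      by (metis add.assoc)
  qed
  then have "riesz_sup f (pprt x) + riesz_sup f b = riesz_sup f (pprt (- x)) + riesz_sup f a"
    by (metis assms(1,2) riesz_add zero_le_pprt)
  then show ?thesis by (simp add: algebra_simps)
qed

lemma riesz_sup_0 [simp]: "riesz_sup f 0 = 0"
  using riesz_add[of 0 0] by simp

lemma riesz_pos_bounded_linear:
  "bounded_linear (\<lambda>x. riesz_sup f (pprt x) - riesz_sup f (pprt (- x)))" (is "bounded_linear ?g")
proof (rule bounded_linear_intro[where K = "norm f * 2"])
  fix x y
  have "?g (x + y) = riesz_sup f (pprt x + pprt y) - riesz_sup f (pprt (- x) + pprt (- y))"
    by (rule riesz_diff) (simp_all add: add_diff_add pprt_minus_pprt)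
  then show "?g (x + y) = ?g x + ?g y"
    by (simp add: riesz_add)
next
  fix r :: real and x
  have pos: "?g (s *\<^sub>R z) = s *\<^sub>R ?g z" if "0 < s" for s z
  proof -
    have "?g (s *\<^sub>R z) = riesz_sup f (s *\<^sub>R pprt z) - riesz_sup f (s *\<^sub>R pprt (- z))"
      by (rule riesz_diff)
        (use that in \<open>simp_all add: scaleR_nonneg_nonneg scaleR_diff_right[symmetric] pprt_minus_pprt\<close>)
    then show ?thesis
      using that by (simp add: riesz_scale scaleR_diff_right)
  qed
  have neg: "?g (- z) = - ?g z" for z by simp
  consider "r > 0" | "r = 0" | "r < 0" by linarith
  then show "?g (r *\<^sub>R x) = r *\<^sub>R ?g x"
  proof cases
    case 1 then show ?thesis by (rule pos)
  next
    case 2 then show ?thesis by simp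
  next
    case 3
    then have "?g ((- r) *\<^sub>R (- x)) = (- r) *\<^sub>R ?g (- x)" by (intro pos) simp
    then have "?g (r *\<^sub>R x) = (- r) *\<^sub>R (- ?g x)" unfolding neg by simp
    then show ?thesis by (simp only: scaleR_minus_left scaleR_minus_right minus_minus)
  qed
next
  fix x
  have "norm (?g x) \<le> norm f * norm (pprt x) + norm f * norm (pprt (- x))"
    by (meson add_mono norm_triangle_ineq4 order_trans riesz_norm zero_le_pprt)
  also have "\<dots> \<le> norm f * norm x + norm f * norm x"
    using norm_pprt_le[of x] norm_pprt_le[of "- x"]
    by (intro add_mono mult_left_mono) auto
  finally show "norm (?g x) \<le> norm x * (norm f * 2)"
    by (simp add: algebra_simps)
qed

lemma riesz_pos_apply: "0 \<le> x \<Longrightarrow> riesz_pos f x = riesz_sup f x"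
  unfolding riesz_pos_def by (simp add: bounded_linear_Blinfun_apply riesz_pos_bounded_linear)

end

instantiation blinfun :: (banach_lattice, order_unit_banach_lattice) banach_lattice
begin

definition less_eq_blinfun :: "('a \<Rightarrow>\<^sub>L 'b) \<Rightarrow> ('a \<Rightarrow>\<^sub>L 'b) \<Rightarrow> bool"
  where "f \<le> g \<longleftrightarrow> (\<forall>x\<ge>0. blinfun_apply f x \<le> blinfun_apply g x)"

definition less_blinfun :: "('a \<Rightarrow>\<^sub>L 'b) \<Rightarrow> ('a \<Rightarrow>\<^sub>L 'b) \<Rightarrow> bool"
  where "f < g \<longleftrightarrow> f \<le> g \<and> \<not> g \<le> (f :: 'a \<Rightarrow>\<^sub>L 'b)"

text \<open>
  Riesz--Kantorovich: the positive part of \<open>f\<close> maps \<open>x \<ge> 0\<close> to the supremum of \<open>f\<close> over the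
  order interval from \<open>0\<close> to \<open>x\<close>.
\<close>

definition sup_blinfun :: "('a \<Rightarrow>\<^sub>L 'b) \<Rightarrow> ('a \<Rightarrow>\<^sub>L 'b) \<Rightarrow> ('a \<Rightarrow>\<^sub>L 'b)"
  where "sup f g = f + riesz_pos (g - f)"

definition inf_blinfun :: "('a \<Rightarrow>\<^sub>L 'b) \<Rightarrow> ('a \<Rightarrow>\<^sub>L 'b) \<Rightarrow> ('a \<Rightarrow>\<^sub>L 'b)"
  where "inf f g = - sup (- f) (- g :: 'a \<Rightarrow>\<^sub>L 'b)"

definition abs_blinfun :: "('a \<Rightarrow>\<^sub>L 'b) \<Rightarrow> ('a \<Rightarrow>\<^sub>L 'b)"
  where "\<bar>f\<bar> = sup f (- f :: 'a \<Rightarrow>\<^sub>L 'b)"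

instance
proof
  fix f g h :: "'a \<Rightarrow>\<^sub>L 'b" and r s :: real
  have sup1: "f \<le> sup f g" for f g :: "'a \<Rightarrow>\<^sub>L 'b"
    by (simp add: less_eq_blinfun_def sup_blinfun_def blinfun.add_left riesz_pos_apply riesz_nonneg)
  have sup2: "g \<le> sup f g" for f g :: "'a \<Rightarrow>\<^sub>L 'b"
  proof -
    have "g x \<le> f x + riesz_sup (g - f) x" if "0 \<le> x" for x
      using riesz_upper[of x x "g - f"] that by (simp add: blinfun.diff_left diff_le_eq add.commute)
    then show ?thesis
      by (simp add: less_eq_blinfun_def sup_blinfun_def blinfun.add_left riesz_pos_apply)
  qed
  have sup3: "sup f g \<le> h" if "f \<le> h" "g \<le> h" for f g h :: "'a \<Rightarrow>\<^sub>L 'b"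
  proof -
    have "riesz_sup (g - f) x \<le> h x - f x" if x: "0 \<le> x" for x
    proof (rule riesz_least[OF x])
      fix y assume y: "0 \<le> y" "y \<le> x"
      have "(g - f) y \<le> (h - f) y"
        using \<open>g \<le> h\<close> y by (simp add: less_eq_blinfun_def blinfun.diff_left)
      also have "\<dots> \<le> (h - f) x"
      proof -
        have "f (x - y) \<le> h (x - y)"
          using \<open>f \<le> h\<close> y by (simp add: less_eq_blinfun_def)
        then show ?thesis
          by (simp add: blinfun.diff_left blinfun.diff_right algebra_simps)
      qed
      finally show "(g - f) y \<le> h x - f x" by (simp add: blinfun.diff_left)
    qed
    then show ?thesis
      by (simp add: less_eq_blinfun_def sup_blinfun_def blinfun.add_left riesz_pos_apply
          le_diff_eq add.commute)
  qed
  have neg: "f \<le> - g \<longleftrightarrow> g \<le> - f" "- f \<le> g \<longleftrightarrow> - g \<le> f" for f g :: "'a \<Rightarrow>\<^sub>L 'b"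
    by (auto simp: less_eq_blinfun_def blinfun.minus_left intro: le_imp_neg_le
        minus_le_iff[THEN iffD1] le_minus_iff[THEN iffD1])
  have antisym: "f = g" if "f \<le> g" "g \<le> f" for f g :: "'a \<Rightarrow>\<^sub>L 'b"
  proof (rule blinfun_eqI)
    fix x
    have "f z = g z" if "0 \<le> z" for z
      using \<open>f \<le> g\<close> \<open>g \<le> f\<close> that unfolding less_eq_blinfun_def by (meson order.antisym)
    then have "f (pprt x) - f (pprt (- x)) = g (pprt x) - g (pprt (- x))"
      by simp
    then show "f x = g x"
      by (simp add: blinfun.diff_right[symmetric] pprt_minus_pprt)
  qed
  show "(f < g) = (f \<le> g \<and> \<not> g \<le> f)" by (rule less_blinfun_def)
  show "f \<le> f" by (simp add: less_eq_blinfun_def)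
  show "f \<le> h" if "f \<le> g" "g \<le> h"
    using that unfolding less_eq_blinfun_def by (meson order_trans)
  show "f \<le> g \<Longrightarrow> g \<le> f \<Longrightarrow> f = g" by (rule antisym)
  show "f \<le> g \<Longrightarrow> h + f \<le> h + g"
    by (simp add: less_eq_blinfun_def blinfun.add_left)
  show "r *\<^sub>R f \<le> r *\<^sub>R g" if "f \<le> g" "0 \<le> r"
    using that by (simp add: less_eq_blinfun_def blinfun.scaleR_left scaleR_left_mono)
  show "r *\<^sub>R f \<le> s *\<^sub>R f" if "r \<le> s" "0 \<le> f"
    using that by (simp add: less_eq_blinfun_def blinfun.scaleR_left scaleR_right_mono)
  show "f \<le> sup f g" "g \<le> sup f g" by (fact sup1 sup2)+
  show "g \<le> f \<Longrightarrow> h \<le> f \<Longrightarrow> sup g h \<le> f" by (rule sup3)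
  show "inf f g \<le> f" "inf f g \<le> g"
    unfolding inf_blinfun_def by (subst neg(2), rule sup1 sup2)+
  show "f \<le> inf g h" if "f \<le> g" "f \<le> h"
    unfolding inf_blinfun_def
    by (subst neg(1), rule sup3) (use that in \<open>simp_all add: less_eq_blinfun_def blinfun.minus_left\<close>)
  show "\<bar>f\<bar> = sup f (- f)" by (rule abs_blinfun_def)
  show "norm f \<le> norm g" if fg: "\<bar>f\<bar> \<le> \<bar>g\<bar>"
  proof (rule norm_blinfun_bound)
    fix x
    have absg: "\<bar>g\<bar> z \<le> (norm g * norm z) *\<^sub>R order_unit" if z: "0 \<le> z" for z
    proof -
      have "riesz_sup (g - - g) z \<le> (norm g * norm z) *\<^sub>R order_unit + g z"
      proof (rule riesz_least[OF z])
        fix y assume y: "0 \<le> y" "y \<le> z"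
        have "\<bar>2 *\<^sub>R y - z\<bar> \<le> \<bar>z\<bar>"
        proof -
          have "2 *\<^sub>R y - z \<le> z" "- (2 *\<^sub>R y - z) \<le> z"
            using y add_mono[of y z y z] by (simp_all add: scaleR_2 algebra_simps)
          then show ?thesis using z by (simp add: abs_le_iff)
        qed
        then have "norm (2 *\<^sub>R y - z) \<le> norm z" by (rule norm_mono_abs)
        then have n: "norm (g (2 *\<^sub>R y - z)) \<le> norm g * norm z"
          by (meson mult_left_mono norm_blinfun norm_ge_zero order_trans)
        have "\<bar>g (2 *\<^sub>R y - z)\<bar> \<le> (norm g * norm z) *\<^sub>R order_unit"
          using n by (subst (asm) norm_le_order_unit) auto
        then have "g (2 *\<^sub>R y - z) \<le> (norm g * norm z) *\<^sub>R order_unit"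
          by (meson abs_ge_self order_trans)
        then show "(g - - g) y \<le> (norm g * norm z) *\<^sub>R order_unit + g z"
          by (simp add: blinfun.add_left blinfun.add_right blinfun.diff_right scaleR_2 diff_le_eq)
      qed
      moreover have "\<bar>g\<bar> = - g + riesz_pos (g - - g)"
      proof -
        have "sup g (- g) = sup (- g) g"
          by (intro antisym sup3 sup1 sup2)
        then show ?thesis
          unfolding abs_blinfun_def by (simp only: sup_blinfun_def)
      qed
      ultimately show ?thesis
        using z by (simp add: blinfun.diff_left riesz_pos_apply diff_le_eq)
    qed
    have le: "f z \<le> \<bar>g\<bar> z" "- f z \<le> \<bar>g\<bar> z" if "0 \<le> z" for z
    proof -
      have "f z \<le> \<bar>f\<bar> z" "(- f) z \<le> \<bar>f\<bar> z" "\<bar>f\<bar> z \<le> \<bar>g\<bar> z"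
        using sup1[of f "- f"] sup2[of "- f" f] fg that
        by (simp_all add: abs_blinfun_def less_eq_blinfun_def)
      then show "f z \<le> \<bar>g\<bar> z" "- f z \<le> \<bar>g\<bar> z"
        by (auto simp: blinfun.minus_left intro: order_trans)
    qed
    have x: "f x = f (pprt x) - f (pprt (- x))"
      by (simp add: blinfun.diff_right[symmetric] pprt_minus_pprt)
    have a: "pprt x + pprt (- x) = \<bar>x\<bar>"
      by (simp add: abs_prts pprt_neg)
    have "f x \<le> \<bar>g\<bar> (pprt x) + \<bar>g\<bar> (pprt (- x))" "- f x \<le> \<bar>g\<bar> (pprt x) + \<bar>g\<bar> (pprt (- x))"
      unfolding x using le[of "pprt x"] le[of "pprt (- x)"]
      using add_mono[of "f (pprt x)" _ "- f (pprt (- x))"] add_mono[of "- f (pprt x)" _ "f (pprt (- x))"]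
      by simp_all
    then have "\<bar>f x\<bar> \<le> \<bar>g\<bar> \<bar>x\<bar>"
      by (simp add: abs_le_iff blinfun.add_right[symmetric] a)
    also have "\<dots> \<le> (norm g * norm x) *\<^sub>R order_unit"
      using absg[of "\<bar>x\<bar>"] by (simp add: norm_abs_eq)
    finally show "norm (f x) \<le> norm g * norm x"
      by (subst norm_le_order_unit) auto
  qed simp
qed

end

section \<open>Adjoints\<close>

definition dual_adjoint ::
    "('a::real_normed_vector \<Rightarrow>\<^sub>L 'b::real_normed_vector) \<Rightarrow> ('b \<Rightarrow>\<^sub>L real) \<Rightarrow>\<^sub>L ('a \<Rightarrow>\<^sub>L real)"
  where "dual_adjoint T = Blinfun (\<lambda>\<phi>. \<phi> o\<^sub>L T)"

lemma dual_adjoint_apply: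
  fixes T :: "'a::real_normed_vector \<Rightarrow>\<^sub>L 'b::real_normed_vector"
  shows "dual_adjoint T \<phi> = \<phi> o\<^sub>L T"
proof -
  have "bounded_linear (\<lambda>\<phi> :: 'b \<Rightarrow>\<^sub>L real. \<phi> o\<^sub>L T)"
    by (rule bounded_bilinear.bounded_linear_left[OF bounded_bilinear_blinfun_compose])
  then show ?thesis
    by (simp add: dual_adjoint_def bounded_linear_Blinfun_apply)
qed

section \<open>Regular operators\<close>

definition positive_operator :: "('a::banach_lattice \<Rightarrow> 'b::banach_lattice) \<Rightarrow> bool"
  where "positive_operator P \<longleftrightarrow> linear P \<and> (\<forall>x\<ge>0. 0 \<le> P x)"

definition regular_operator :: "('a::banach_lattice \<Rightarrow> 'b::banach_lattice) \<Rightarrow> bool"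
  where "regular_operator T \<longleftrightarrow>
    (\<exists>P Q. positive_operator P \<and> positive_operator Q \<and> T = (\<lambda>x. P x - Q x))"

text \<open>
  Regular operators are automatically bounded, so that \<open>Blinfun T\<close> is the operator \<open>T\<close> itself.
\<close>

lemma nonneg_limit:
  fixes x :: "'a::banach_lattice"
  assumes "X \<longlonglongrightarrow> x" "\<And>n. 0 \<le> X n"
  shows "0 \<le> x"
proof -
  have "norm (pprt (- x)) \<le> norm (X n - x)" for n
  proof -
    have "- x \<le> X n - x"
      using assms(2)[of n] by simp
    then have "pprt (- x) \<le> \<bar>X n - x\<bar>"
      unfolding pprt_def by (meson abs_ge_self abs_ge_zero order_trans le_supI)
    then show ?thesis
      by (metis norm_abs_eq norm_mono_nonneg zero_le_pprt)
  qed
  moreover have "(\<lambda>n. norm (X n - x)) \<longlonglongrightarrow> 0"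
    using assms(1) by (simp add: LIM_zero tendsto_norm_zero)
  ultimately have "norm (pprt (- x)) \<le> 0"
    by (meson LIMSEQ_le_const)
  then have "pprt (- x) = 0" by simp
  then show ?thesis
    by (simp add: le_zero_iff_zero_pprt[symmetric])
qed

lemma positive_operator_mono: "positive_operator P \<Longrightarrow> x \<le> y \<Longrightarrow> P x \<le> P y"
  unfolding positive_operator_def by (metis diff_ge_0_iff_ge linear_diff)

lemma positive_operator_bounded:
  fixes P :: "'a::banach_lattice \<Rightarrow> 'b::banach_lattice"
  assumes P: "positive_operator P"
  shows "bounded_linear P"
proof (rule ccontr)
  assume not: "\<not> bounded_linear P"
  have lin: "linear P" using P by (simp add: positive_operator_def)
  have "\<exists>x. K * norm x < norm (P x)" for K
  proof (rule ccontr)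
    assume "\<nexists>x. K * norm x < norm (P x)"
    then have "norm (P x) \<le> norm x * K" for x
      by (metis mult.commute not_le)
    then have "bounded_linear P"
      by (intro bounded_linear_intro[where K = K]) (simp_all add: linear_add[OF lin] linear_scale[OF lin])
    with not show False ..
  qed
  then obtain x where x: "\<And>n. (real n * 2 ^ n) * norm (x n) < norm (P (x n))"
    using choice[of "\<lambda>n x. (real n * 2 ^ n) * norm x < norm (P x)"] by blast
  have x0: "norm (x n) \<noteq> 0" for n
    using x[of n] lin by (auto simp: linear_0)
  define y where "y n = ((1/2) ^ n / norm (x n)) *\<^sub>R \<bar>x n\<bar>" for n
  have ypos: "0 \<le> y n" for n
    unfolding y_def by (intro scaleR_nonneg_nonneg) auto
  have ynorm: "norm (y n) = (1/2) ^ n" for n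
    using x0[of n] by (simp add: y_def norm_abs_eq)
  have summ: "summable y"
    by (rule summable_norm_cancel) (simp add: ynorm summable_geometric)
  have le: "y n \<le> suminf y" for n
  proof -
    have "(\<lambda>N. (\<Sum>i<N. y i) - y n) \<longlonglongrightarrow> suminf y - y n"
      by (intro tendsto_intros summable_LIMSEQ summ)
    then have "(\<lambda>N. (\<Sum>i<N + Suc n. y i) - y n) \<longlonglongrightarrow> suminf y - y n"
      by (rule LIMSEQ_ignore_initial_segment)
    then have "0 \<le> suminf y - y n"
    proof (rule nonneg_limit)
      fix N
      have "(\<Sum>i<N + Suc n. y i) = y n + (\<Sum>i\<in>{..<N + Suc n} - {n}. y i)"
        by (rule sum.remove) auto
      moreover have "0 \<le> (\<Sum>i\<in>{..<N + Suc n} - {n}. y i)"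
        by (intro sum_nonneg ypos)
      ultimately show "0 \<le> (\<Sum>i<N + Suc n. y i) - y n" by simp
    qed
    then show ?thesis by simp
  qed
  have big: "real n \<le> norm (P (suminf y))" for n
  proof -
    have "\<bar>P (x n)\<bar> \<le> \<bar>P \<bar>x n\<bar>\<bar>"
    proof -
      have "P (x n) \<le> P \<bar>x n\<bar>" "- P (x n) \<le> P \<bar>x n\<bar>"
        using positive_operator_mono[OF P, of "x n" "\<bar>x n\<bar>"]
          positive_operator_mono[OF P, of "- x n" "\<bar>x n\<bar>"]
        by (simp_all add: linear_neg[OF lin] abs_ge_minus_self abs_ge_self)
      then have "\<bar>P (x n)\<bar> \<le> P \<bar>x n\<bar>" by (simp add: abs_le_iff)
      then show ?thesis using abs_ge_self order_trans by blast
    qed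
    then have "norm (P (x n)) \<le> norm (P \<bar>x n\<bar>)"
      by (rule norm_mono_abs)
    then have "(real n * 2 ^ n) * norm (x n) \<le> norm (P \<bar>x n\<bar>)"
      using x[of n] by linarith
    then have "((1/2) ^ n / norm (x n)) * ((real n * 2 ^ n) * norm (x n))
        \<le> ((1/2) ^ n / norm (x n)) * norm (P \<bar>x n\<bar>)"
      by (intro mult_left_mono) auto
    also have "\<dots> = norm (P (y n))"
      by (simp add: y_def linear_scale[OF lin])
    also have "((1/2) ^ n / norm (x n)) * ((real n * 2 ^ n) * norm (x n)) = real n"
      using x0[of n] by (simp add: power_one_over)
    also have "norm (P (y n)) \<le> norm (P (suminf y))"
      using P ypos le by (intro norm_mono_nonneg positive_operator_mono[OF P])
        (auto simp: positive_operator_def)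
    finally show ?thesis .
  qed
  obtain n where "norm (P (suminf y)) < real n"
    using reals_Archimedean2 by blast
  with big[of n] show False by simp
qed

lemma regular_operator_bounded: "regular_operator T \<Longrightarrow> bounded_linear T"
  unfolding regular_operator_def
  by (metis bounded_linear_sub positive_operator_bounded)

lemma Blinfun_regular_apply: "regular_operator T \<Longrightarrow> Blinfun T x = T x"
  by (simp add: bounded_linear_Blinfun_apply regular_operator_bounded)

section \<open>Sequences and the classes of spaces and operators\<close>

definition disjoint_seq :: "(nat \<Rightarrow> 'a::banach_lattice) \<Rightarrow> bool"
  where "disjoint_seq x \<longleftrightarrow> (\<forall>m n. m \<noteq> n \<longrightarrow> inf \<bar>x m\<bar> \<bar>x n\<bar> = 0)"

definition weakly_null :: "(nat \<Rightarrow> 'a::real_normed_vector) \<Rightarrow> bool"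
  where "weakly_null x \<longleftrightarrow> (\<forall>\<phi> :: 'a \<Rightarrow>\<^sub>L real. (\<lambda>n. \<phi> (x n)) \<longlonglongrightarrow> 0)"

definition weak_star_null :: "(nat \<Rightarrow> ('a::real_normed_vector \<Rightarrow>\<^sub>L real)) \<Rightarrow> bool"
  where "weak_star_null \<phi> \<longleftrightarrow> (\<forall>x. (\<lambda>n. \<phi> n x) \<longlonglongrightarrow> 0)"

definition dual_positive_schur :: "'g::banach_lattice itself \<Rightarrow> bool"
  where "dual_positive_schur _ \<longleftrightarrow>
    (\<forall>\<phi> :: nat \<Rightarrow> ('g \<Rightarrow>\<^sub>L real). (\<forall>n. 0 \<le> \<phi> n) \<and> weak_star_null \<phi> \<longrightarrow> \<phi> \<longlonglongrightarrow> 0)"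

definition almost_limited :: "('y::banach \<Rightarrow>\<^sub>L 'g::banach_lattice) \<Rightarrow> bool"
  where "almost_limited S \<longleftrightarrow>
    (\<forall>\<phi> :: nat \<Rightarrow> ('g \<Rightarrow>\<^sub>L real). disjoint_seq \<phi> \<and> weak_star_null \<phi> \<longrightarrow>
      (\<lambda>n. dual_adjoint S (\<phi> n)) \<longlonglongrightarrow> 0)"

definition almost_dunford_pettis :: "('g::banach_lattice \<Rightarrow>\<^sub>L 'y::banach) \<Rightarrow> bool"
  where "almost_dunford_pettis S \<longleftrightarrow>
    (\<forall>x :: nat \<Rightarrow> 'g. disjoint_seq x \<and> weakly_null x \<longrightarrow> (\<lambda>n. S (x n)) \<longlonglongrightarrow> 0)"

end

theory Submission
  imports Defs
begin

text \<open>
  Both conclusions say that \<open>T\<^sup>*\<^sup>*\<close> maps certain disjoint sequences of \<open>E\<^sup>*\<^sup>*\<close> to norm null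
  sequences: weak* null ones for the first, weakly null ones for the second.  Weakly null
  sequences in a dual space are weak* null, so it is enough to treat a disjoint weak* null
  sequence \<open>\<phi>\<^sub>n\<close>.  Writing \<open>T\<close> as a difference of positive operators reduces the claim to a
  positive \<open>P\<close>.  Then \<open>\<bar>P\<^sup>*\<^sup>* \<phi>\<^sub>n\<bar> \<le> P\<^sup>*\<^sup>* \<bar>\<phi>\<^sub>n\<bar>\<close>, and if the moduli \<open>\<bar>\<phi>\<^sub>n\<bar>\<close> are still weak* null,
  the sequence \<open>P\<^sup>*\<^sup>* \<bar>\<phi>\<^sub>n\<bar>\<close> is positive and weak* null in the dual of \<open>F\<^sup>*\<close>, hence norm null by
  the dual positive Schur property of \<open>F\<^sup>*\<close>.

  The heart of the matter is therefore \<open>weak_star_null_abs\<close>: over a dual Banach lattice \<open>E\<^sup>*\<close>,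
  passing to moduli preserves weak* nullity of disjoint sequences.  Suppose \<open>\<bar>\<phi>\<^sub>n\<bar> x \<ge> \<epsilon>\<close>
  infinitely often for some \<open>x \<ge> 0\<close> in \<open>E\<^sup>*\<close>.  Because the \<open>\<phi>\<^sub>n\<close> are disjoint, one can extract
  from \<open>x\<close> pieces \<open>u\<^sub>k \<ge> 0\<close>, all of whose finite sums stay below \<open>x\<close>, such that
  \<open>\<bar>\<phi>\<^sub>n\<bar> u\<^sub>k \<ge> \<epsilon> / 2\<close> for the \<open>k\<close>-th index \<open>n\<close> of a subsequence (\<open>disjoint_functionals_pieces\<close>).
  Choose \<open>\<bar>y\<^sub>k\<bar> \<le> u\<^sub>k\<close> on which \<open>\<phi>\<^sub>n\<close> nearly attains its modulus.  In \<open>E\<^sup>*\<close> the sums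
  \<open>y\<^sub>A = \<Sum>\<^sub>k\<^sub>\<in>\<^sub>A y\<^sub>k\<close> exist pointwise for every set \<open>A\<close> of indices.  Rosenthal's lemma, applied to
  the finitely additive set functions \<open>A \<mapsto> \<bar>\<phi>\<^sub>n\<bar> u\<^sub>A\<close>, gives an infinite \<open>A\<close> for which the diagonal
  term dominates \<open>\<phi>\<^sub>n y\<^sub>A\<close> along \<open>A\<close>; this value then does not tend to \<open>0\<close>, a contradiction.
\<close>

section \<open>Functionals on a Banach lattice\<close>

lemma blinfun_leD: "f \<le> g \<Longrightarrow> 0 \<le> x \<Longrightarrow> blinfun_apply f x \<le> blinfun_apply g x"
  for f g :: "'a::banach_lattice \<Rightarrow>\<^sub>L real"
  by (simp add: less_eq_blinfun_def)

lemma blinfun_apply_nonneg: "0 \<le> f \<Longrightarrow> 0 \<le> x \<Longrightarrow> 0 \<le> blinfun_apply f x"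
  for f :: "'a::banach_lattice \<Rightarrow>\<^sub>L real"
  using blinfun_leD[of 0 f x] by simp

lemma blinfun_apply_mono: "0 \<le> f \<Longrightarrow> x \<le> y \<Longrightarrow> blinfun_apply f x \<le> blinfun_apply f y"
  for f :: "'a::banach_lattice \<Rightarrow>\<^sub>L real"
  using blinfun_apply_nonneg[of f "y - x"] by (simp add: blinfun.diff_right)

lemma abs_blinfun_apply_le:
  fixes f :: "'a::banach_lattice \<Rightarrow>\<^sub>L real"
  shows "\<bar>f x\<bar> \<le> \<bar>f\<bar> \<bar>x\<bar>"
proof -
  have *: "\<bar>f y\<bar> \<le> \<bar>f\<bar> y" if "0 \<le> y" for y
    using blinfun_leD[OF abs_ge_self[of f] that] blinfun_leD[OF abs_ge_minus_self[of f] that]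
    by (simp add: blinfun.minus_left abs_le_iff)
  have "f x = f (pprt x) - f (pprt (- x))"
    by (simp add: blinfun.diff_right[symmetric] pprt_minus_pprt)
  also have "\<bar>\<dots>\<bar> \<le> \<bar>f\<bar> (pprt x) + \<bar>f\<bar> (pprt (- x))"
    using *[of "pprt x"] *[of "pprt (- x)"] by simp
  also have "\<dots> = \<bar>f\<bar> \<bar>x\<bar>"
    by (simp add: blinfun.add_right[symmetric] abs_prts pprt_neg)
  finally show ?thesis .
qed

text \<open>
  This is the formula \<open>\<bar>f\<bar> x = sup {f y. \<bar>y\<bar> \<le> x}\<close>.  It comes from \<open>\<bar>f\<bar> = f + (- 2 f)\<^sup>+\<close>:
  a point \<open>z\<close> of \<open>{0..x}\<close> that is nearly optimal for the positive part yields \<open>y = x - 2 z\<close>.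
\<close>

lemma abs_blinfun_approx:
  fixes f :: "'a::banach_lattice \<Rightarrow>\<^sub>L real"
  assumes "0 \<le> x" "0 < \<delta>"
  obtains y where "\<bar>y\<bar> \<le> x" "\<bar>f\<bar> x - \<delta> < f y"
proof -
  have "\<bar>f\<bar> x = f x + riesz_sup (- f - f) x"
    using assms by (simp add: abs_blinfun_def sup_blinfun_def blinfun.add_left riesz_pos_apply)
  moreover have "\<not> riesz_sup (- f - f) x \<le> riesz_sup (- f - f) x - \<delta>"
    using assms by simp
  then obtain z where z: "0 \<le> z" "z \<le> x" "riesz_sup (- f - f) x - \<delta> < (- f - f) z"
    using riesz_least[OF assms(1), of "- f - f"] by (meson not_le)
  moreover have "\<bar>x - 2 *\<^sub>R z\<bar> \<le> x"
    using z add_mono[of z x z x] by (simp add: abs_le_iff scaleR_2 algebra_simps)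
  ultimately show thesis
    by (intro that[of "x - 2 *\<^sub>R z"])
      (simp_all add: blinfun.diff_right blinfun.diff_left blinfun.minus_left blinfun.scaleR_right)
qed

text \<open>
  Disjoint functionals live, up to \<open>\<delta>\<close>, on complementary parts of \<open>x\<close>: since
  \<open>inf f g = f - (f - g)\<^sup>+\<close> vanishes, the supremum of \<open>f - g\<close> over \<open>{0..x}\<close> is \<open>f x\<close>,
  and a nearly optimal \<open>u\<close> carries \<open>f\<close> and avoids \<open>g\<close>.
\<close>

lemma disjoint_functionals_split:
  fixes f g :: "'a::banach_lattice \<Rightarrow>\<^sub>L real"
  assumes "0 \<le> f" "0 \<le> g" "inf f g = 0" "0 \<le> x" "0 < \<delta>"
  obtains u where "0 \<le> u" "u \<le> x" "f (x - u) \<le> \<delta>" "g u \<le> \<delta>"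
proof -
  have "riesz_pos (f - g) = f"
    using assms(3) by (simp add: inf_blinfun_def sup_blinfun_def algebra_simps)
  then have "riesz_sup (f - g) x = f x"
    using riesz_pos_apply[OF assms(4), of "f - g"] by simp
  then have "\<not> riesz_sup (f - g) x \<le> f x - \<delta>"
    using assms by simp
  then obtain u where u: "0 \<le> u" "u \<le> x" "f x - \<delta> < (f - g) u"
    using riesz_least[OF assms(4), of "f - g"] by (meson not_le)
  moreover have "f u \<le> f x" "0 \<le> g u"
    using u assms by (auto intro: blinfun_apply_mono blinfun_apply_nonneg)
  ultimately show thesis
    by (intro that[of u]) (auto simp: blinfun.diff_left blinfun.diff_right)
qed

lemma inf_add_eq_0:
  fixes a b c :: "'a::banach_lattice"
  assumes "0 \<le> a" "0 \<le> b" "0 \<le> c" "inf a b = 0" "inf a c = 0"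
  shows "inf a (b + c) = 0"
proof (rule order.antisym)
  have "inf a (b + c) \<le> inf (a + c) (b + c)"
    using assms by (intro inf_mono) auto
  also have "\<dots> = c"
    using assms(4) by (simp add: add_inf_distrib_right[symmetric])
  finally have "inf a (b + c) \<le> inf a c" by simp
  then show "inf a (b + c) \<le> 0" using assms by simp
qed (use assms in simp)

lemma inf_sum_eq_0:
  fixes a :: "'a::banach_lattice"
  assumes "finite S" "0 \<le> a" "\<And>i. i \<in> S \<Longrightarrow> 0 \<le> b i" "\<And>i. i \<in> S \<Longrightarrow> inf a (b i) = 0"
  shows "inf a (\<Sum>i\<in>S. b i) = 0"
  using assms by (induction S) (auto intro!: inf_add_eq_0 sum_nonneg simp: inf_absorb2)

text \<open>
  The uniform boundedness principle, by Baire category: one of the closed sets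
  \<open>{x. \<forall>n. \<bar>\<phi> n x\<bar> \<le> k}\<close> contains a ball.
\<close>

lemma pointwise_bounded_functionals_bounded:
  fixes \<phi> :: "nat \<Rightarrow> ('a::banach \<Rightarrow>\<^sub>L real)"
  assumes bdd: "\<And>x. \<exists>M. \<forall>n. \<bar>\<phi> n x\<bar> \<le> M"
  obtains M where "\<And>n. norm (\<phi> n) \<le> M"
proof -
  define C where "C k = {x. \<forall>n. \<bar>\<phi> n x\<bar> \<le> real k}" for k :: nat
  have cl: "closed (C k)" for k
    unfolding C_def by (intro closed_Collect_all closed_Collect_le continuous_intros)
  have "\<exists>k. x \<in> C k" for x
  proof -
    obtain M where "\<forall>n. \<bar>\<phi> n x\<bar> \<le> M" using bdd by blast
    moreover obtain k where "M \<le> real k" using real_arch_simple by blast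
    ultimately show ?thesis unfolding C_def by (auto intro: order_trans)
  qed
  then have un: "\<Union>(range C) = UNIV" by blast
  have "\<exists>k. interior (C k) \<noteq> {}"
  proof (rule ccontr)
    assume "\<not> ?thesis"
    then have "euclidean interior_of \<Union>(range C) = {}"
      by (intro Baire_category_alt) (auto simp: cl completely_metrizable_space_euclidean)
    then show False by (simp add: un)
  qed
  then obtain k x where "x \<in> interior (C k)" by blast
  then obtain e where e: "0 < e" "cball x e \<subseteq> C k"
    using open_contains_cball[of "interior (C k)"] interior_subset by (metis open_interior subset_trans)
  have "norm (\<phi> n) \<le> 2 * real k / e" for n
  proof (rule norm_blinfun_bound)
    fix y
    show "norm (\<phi> n y) \<le> 2 * real k / e * norm y"
    proof (cases "y = 0")
      case False
      define z where "z = (e / norm y) *\<^sub>R y"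
      have "x + z \<in> cball x e" "x \<in> cball x e"
        using e False by (auto simp: z_def dist_norm)
      then have "\<bar>\<phi> n (x + z)\<bar> \<le> real k" "\<bar>\<phi> n x\<bar> \<le> real k"
        using e unfolding C_def by blast+
      then have "\<bar>\<phi> n z\<bar> \<le> 2 * real k"
        by (simp add: blinfun.add_right)
      also have "\<bar>\<phi> n z\<bar> = e / norm y * \<bar>\<phi> n y\<bar>"
        using e by (simp add: z_def blinfun.scaleR_right abs_mult)
      finally show ?thesis using e False by (simp add: field_simps)
    qed simp
  qed (use e in simp)
  then show thesis by (rule that)
qed

section \<open>Order bounded pieces carrying disjoint functionals\<close>

text \<open>
  For finitely many disjoint functionals, \<open>disjoint_functionals_split\<close> separates one of them from
  the sum of the others; the remaining part of \<open>x\<close> is then shared among the others.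
\<close>

lemma finite_disjoint_functionals_split:
  fixes \<psi> :: "'i \<Rightarrow> ('a::banach_lattice \<Rightarrow>\<^sub>L real)"
  assumes "finite S" "\<And>i. 0 \<le> \<psi> i" "\<And>i j. i \<noteq> j \<Longrightarrow> inf (\<psi> i) (\<psi> j) = 0"
    and "0 \<le> x" "0 < \<delta>"
  shows "\<exists>v. (\<forall>i\<in>S. 0 \<le> v i) \<and> (\<Sum>i\<in>S. v i) \<le> x \<and> (\<forall>i\<in>S. \<psi> i (x - v i) \<le> \<delta>)"
  using assms(1,4,5)
proof (induction S arbitrary: x \<delta>)
  case (insert a S)
  have "inf (\<psi> a) (\<Sum>i\<in>S. \<psi> i) = 0"
    using insert.hyps assms(2) by (intro inf_sum_eq_0 assms(3)) auto
  then obtain u where u: "0 \<le> u" "u \<le> x" "\<psi> a (x - u) \<le> \<delta> / 2" "(\<Sum>i\<in>S. \<psi> i) u \<le> \<delta> / 2"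
    using disjoint_functionals_split[of "\<psi> a" "\<Sum>i\<in>S. \<psi> i" x "\<delta> / 2"] insert.prems assms(2)
    by (metis half_gt_zero sum_nonneg)
  obtain v where v: "\<forall>i\<in>S. 0 \<le> v i" "(\<Sum>i\<in>S. v i) \<le> x - u" "\<forall>i\<in>S. \<psi> i (x - u - v i) \<le> \<delta> / 2"
    using insert.IH[of "x - u" "\<delta> / 2"] u insert.prems by auto
  have small: "\<psi> i u \<le> \<delta> / 2" if "i \<in> S" for i
  proof -
    have "\<psi> i u \<le> (\<Sum>j\<in>S. \<psi> j u)"
      using insert.hyps that u assms(2) by (intro member_le_sum) (auto intro: blinfun_apply_nonneg)
    also have "\<dots> \<le> \<delta> / 2" using u by (simp add: blinfun.sum_left)
    finally show ?thesis .
  qed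
  have sum: "(\<Sum>i\<in>S. (v(a := u)) i) = (\<Sum>i\<in>S. v i)"
    using insert.hyps by (intro sum.cong) auto
  have "\<psi> i (x - v i) \<le> \<delta>" if "i \<in> S" for i
    using small[OF that] v(3)[rule_format, OF that] by (simp add: blinfun.diff_right)
  moreover have "(\<Sum>i\<in>insert a S. (v(a := u)) i) \<le> x"
    using insert.hyps v(2) sum by (simp add: algebra_simps)
  moreover have "\<psi> a (x - u) \<le> \<delta>" using u insert.prems by linarith
  ultimately show ?case
    using u v(1) by (intro exI[of _ "v(a := u)"]) auto
qed simp

text \<open>
  A piece that carries one functional may still be seen by all later ones, and finite
  splittings do not control infinitely many functionals.  The remedy is to pass to a subsequence:
  split \<open>x\<close> into more than \<open>M / \<delta>\<close> pieces.  As \<open>\<psi> m x \<le> M\<close>, each \<open>\<psi> m\<close> is at most \<open>\<delta>\<close> on one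
  of them, and by the pigeonhole principle some piece serves infinitely many \<open>m\<close>.
\<close>

lemma split_off_piece:
  fixes \<psi> :: "nat \<Rightarrow> ('a::banach_lattice \<Rightarrow>\<^sub>L real)"
  assumes pos: "\<And>n. 0 \<le> \<psi> n" and disj: "\<And>m n. m \<noteq> n \<Longrightarrow> inf (\<psi> m) (\<psi> n) = 0"
    and "0 \<le> x" "0 < \<delta>" and M: "\<And>n. \<psi> n x \<le> M" and I: "infinite I"
  obtains n u J where "n \<in> I" "0 \<le> u" "u \<le> x" "\<psi> n (x - u) \<le> \<delta>"
    "infinite J" "J \<subseteq> I \<inter> {n<..}" "\<And>m. m \<in> J \<Longrightarrow> \<psi> m u \<le> \<delta>"
proof -
  obtain N where N: "M < real N * \<delta>"
    using ex_less_of_nat_mult[OF \<open>0 < \<delta>\<close>] by blast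
  obtain S where S: "finite S" "card S = N" "S \<subseteq> I"
    using infinite_arbitrarily_large[OF I] by blast
  obtain v where v: "\<forall>i\<in>S. 0 \<le> v i" "(\<Sum>i\<in>S. v i) \<le> x" "\<forall>i\<in>S. \<psi> i (x - v i) \<le> \<delta>"
    using finite_disjoint_functionals_split[where \<psi> = \<psi>, OF S(1) pos disj assms(3,4)] by blast
  have "\<exists>i\<in>S. \<psi> m (v i) \<le> \<delta>" for m
  proof (rule ccontr)
    assume "\<not> ?thesis"
    then have "real (card S) * \<delta> \<le> (\<Sum>i\<in>S. \<psi> m (v i))"
      by (intro sum_bounded_below) auto
    also have "\<dots> = \<psi> m (\<Sum>i\<in>S. v i)" by (simp add: blinfun.sum_right)
    also have "\<dots> \<le> M"
      using blinfun_apply_mono[OF pos v(2)] M order_trans by blast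
    finally show False using N S by simp
  qed
  then obtain n where n: "n \<in> S" "infinite {m \<in> I. \<psi> m (v n) \<le> \<delta>}"
    using pigeonhole_infinite_rel[OF I S(1), of "\<lambda>m i. \<psi> m (v i) \<le> \<delta>"] by blast
  have "infinite ({m \<in> I. \<psi> m (v n) \<le> \<delta>} - {..n})"
    using n(2) by (intro Diff_infinite_finite) auto
  moreover have "v n \<le> x"
    using sum_mono2[of S "{n}" v] S v n by (auto intro: order_trans)
  ultimately show thesis
    using n S v by (intro that[of n "v n" "{m \<in> I. \<psi> m (v n) \<le> \<delta>} - {..n}"]) auto
qed

text \<open>
  Pieces are split off one after the other, with errors \<open>\<epsilon> / 2 ^ (k + 2)\<close> that add up to
  \<open>\<epsilon> / 2\<close>.  The state of the recursion is the infinite set of indices still available together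
  with the part of \<open>x\<close> that is left; the pieces are the successive differences of the latter,
  so that their sums telescope.
\<close>

lemma disjoint_functionals_pieces:
  fixes \<psi> :: "nat \<Rightarrow> ('a::banach_lattice \<Rightarrow>\<^sub>L real)"
  assumes pos: "\<And>n. 0 \<le> \<psi> n" and disj: "\<And>m n. m \<noteq> n \<Longrightarrow> inf (\<psi> m) (\<psi> n) = 0"
    and "0 \<le> x" "0 < \<epsilon>" and M: "\<And>n. \<psi> n x \<le> M"
    and I: "infinite I" "\<And>n. n \<in> I \<Longrightarrow> \<epsilon> \<le> \<psi> n x"
  obtains r :: "nat \<Rightarrow> nat" and u where "strict_mono r" "\<And>k. 0 \<le> u k" "\<And>K. (\<Sum>k<K. u k) \<le> x"
    "\<And>k. \<epsilon> / 2 \<le> \<psi> (r k) (u k)"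
proof -
  define P where "P k s \<longleftrightarrow> infinite (fst s) \<and> 0 \<le> snd s \<and> snd s \<le> x \<and>
    (\<forall>m\<in>fst s. \<epsilon> / 2 + \<epsilon> / 2 ^ Suc k \<le> \<psi> m (snd s))" for k and s :: "nat set \<times> 'a"
  define Q where "Q s t \<longleftrightarrow> (\<exists>n. n \<in> fst s \<and> fst t \<subseteq> fst s \<inter> {n<..} \<and> snd t \<le> snd s \<and>
    \<epsilon> / 2 \<le> \<psi> n (snd s - snd t))" for s t :: "nat set \<times> 'a"
  have "\<exists>s. \<forall>k. P k (s k) \<and> Q (s k) (s (Suc k))"
  proof (rule dependent_nat_choice)
    show "\<exists>s. P 0 s"
      using assms by (intro exI[of _ "(I, x)"]) (simp add: P_def)
  next
    fix s k assume P: "P k s"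
    define \<delta> where "\<delta> = \<epsilon> / 2 ^ Suc (Suc k)"
    have \<delta>: "0 < \<delta>" "\<epsilon> / 2 ^ Suc k = 2 * \<delta>" using assms by (simp_all add: \<delta>_def)
    have Ms: "\<psi> n (snd s) \<le> M" for n
      using P M[of n] blinfun_apply_mono[OF pos[of n], of "snd s" x] by (simp add: P_def)
    obtain n u J where nuJ: "n \<in> fst s" "0 \<le> u" "u \<le> snd s" "\<psi> n (snd s - u) \<le> \<delta>"
        "infinite J" "J \<subseteq> fst s \<inter> {n<..}" "\<And>m. m \<in> J \<Longrightarrow> \<psi> m u \<le> \<delta>"
      using split_off_piece[of \<psi> "snd s" \<delta> M "fst s"] pos disj \<delta> Ms P unfolding P_def by metis
    have s: "\<epsilon> / 2 + 2 * \<delta> \<le> \<psi> m (snd s)" if "m \<in> fst s" for m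
      using P that \<delta> by (simp add: P_def)
    have "\<epsilon> / 2 + \<delta> \<le> \<psi> m (snd s - u)" if "m \<in> J" for m
      using s[of m] nuJ(6,7) that by (fastforce simp: blinfun.diff_right)
    moreover have "snd s - u \<le> x"
      using nuJ(2) P by (auto simp: P_def diff_le_eq intro: add_increasing2)
    ultimately have "P (Suc k) (J, snd s - u)"
      using nuJ by (simp add: P_def \<delta>_def)
    moreover have "Q s (J, snd s - u)"
      using nuJ s[OF nuJ(1)] \<delta>(1) unfolding Q_def
      by (intro exI[of _ n]) (auto simp: blinfun.diff_right)
    ultimately show "\<exists>t. P (Suc k) t \<and> Q s t" by blast
  qed
  then obtain s where P: "\<And>k. P k (s k)" and Q: "\<And>k. Q (s k) (s (Suc k))" by blast
  obtain r where r: "\<And>k. r k \<in> fst (s k)" "\<And>k. fst (s (Suc k)) \<subseteq> fst (s k) \<inter> {r k<..}"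
      "\<And>k. snd (s (Suc k)) \<le> snd (s k)" "\<And>k. \<epsilon> / 2 \<le> \<psi> (r k) (snd (s k) - snd (s (Suc k)))"
    using Q unfolding Q_def by metis
  show thesis
  proof (rule that[of r "\<lambda>k. snd (s k) - snd (s (Suc k))"])
    show "strict_mono r"
      using r(1,2) by (intro strict_mono_Suc_iff[THEN iffD2]) blast
    fix K
    have "(\<Sum>k<K. snd (s k) - snd (s (Suc k))) = snd (s 0) - snd (s K)"
      by (induction K) auto
    also have "\<dots> \<le> x"
      using P[of 0] P[of K] by (auto simp: P_def diff_le_eq intro: add_increasing2)
    finally show "(\<Sum>k<K. snd (s k) - snd (s (Suc k))) \<le> x" .
  qed (use r in auto)
qed

section \<open>Rosenthal's lemma\<close>

lemma infinite_partition:
  fixes B :: "nat set"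
  assumes "infinite B"
  obtains P :: "nat \<Rightarrow> nat set"
    where "\<And>p. infinite (P p)" "\<And>p. P p \<subseteq> B" "\<And>p q. p \<noteq> q \<Longrightarrow> P p \<inter> P q = {}"
proof
  define e where "e = enumerate B \<circ> prod_encode"
  have inj: "inj e"
    unfolding e_def using assms by (intro inj_compose inj_enumerate inj_prod_encode)
  have "inj (\<lambda>q. e (p, q))" for p
    using injD[OF inj] by (intro injI) blast
  then show "infinite (range (\<lambda>q. e (p, q)))" for p
    by (rule range_inj_infinite)
  show "range (\<lambda>q. e (p, q)) \<subseteq> B" for p
    using enumerate_in_set[OF assms] by (auto simp: e_def)
  show "range (\<lambda>q. e (p, q)) \<inter> range (\<lambda>q. e (p', q)) = {}" if "p \<noteq> p'" for p p'
    using injD[OF inj] that by fast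
qed

text \<open>
  Partition an infinite index set into infinitely many infinite cells.  If no cell has the
  required property, each cell contains an index \<open>k\<close> whose set function loses at least \<open>\<delta>\<close> on
  that cell.  The set of these indices meets the cell only in \<open>k\<close> itself, so on this set the
  bound on the set functions has dropped by \<open>\<delta>\<close>, which can happen only finitely often.
\<close>

lemma rosenthal_lemma:
  fixes \<nu> :: "nat \<Rightarrow> nat set \<Rightarrow> real"
  assumes nonneg: "\<And>k A. 0 \<le> \<nu> k A"
    and add: "\<And>k A B. A \<inter> B = {} \<Longrightarrow> \<nu> k (A \<union> B) = \<nu> k A + \<nu> k B"
    and bound: "\<And>k. \<nu> k UNIV \<le> M" and "0 < \<delta>"
  obtains A where "infinite A" "\<And>k. k \<in> A \<Longrightarrow> \<nu> k (A - {k}) < \<delta>"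
proof -
  have mono: "\<nu> k A \<le> \<nu> k B" if "A \<subseteq> B" for k A B
    using add[of A "B - A" k] nonneg[of k "B - A"] that by (simp add: Un_absorb1)
  have step: "\<exists>A. infinite A \<and> (\<forall>k\<in>A. \<nu> k (A - {k}) < \<delta>)"
    if "infinite B" "\<forall>k\<in>B. \<nu> k B \<le> real n * \<delta>" for B n
    using that
  proof (induction n arbitrary: B)
    case 0
    have "\<nu> k (B - {k}) < \<delta>" if "k \<in> B" for k
      using 0 that mono[of "B - {k}" B k] \<open>0 < \<delta>\<close> by fastforce
    then show ?case using 0 by blast
  next
    case (Suc n)
    obtain P :: "nat \<Rightarrow> nat set" where P: "\<And>p. infinite (P p)" "\<And>p. P p \<subseteq> B" "\<And>p q. p \<noteq> q \<Longrightarrow> P p \<inter> P q = {}"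
      by (rule infinite_partition[OF Suc.prems(1)]) (rule that)
    show ?case
    proof (cases "\<exists>p. \<forall>k\<in>P p. \<nu> k (P p - {k}) < \<delta>")
      case True
      then show ?thesis using P(1) by blast
    next
      case False
      then obtain k where k: "\<And>p. k p \<in> P p" "\<And>p. \<delta> \<le> \<nu> (k p) (P p - {k p})"
        by (metis not_le)
      have "inj k"
        using k(1) P(3) by (metis disjoint_iff injI)
      then have "infinite (range k)" using finite_imageD by blast
      moreover have "\<nu> (k p) (range k) \<le> real n * \<delta>" for p
      proof -
        have "k q \<notin> P p - {k p}" for q
          using k(1)[of q] P(3)[of q p] by (cases "q = p") auto
        then have disjoint: "range k \<inter> (P p - {k p}) = {}" by blast
        have "\<nu> (k p) (range k) + \<nu> (k p) (P p - {k p}) \<le> \<nu> (k p) B"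
          unfolding add[OF disjoint, symmetric] using k(1) P(2) by (intro mono) blast
        moreover have "\<nu> (k p) B \<le> real (Suc n) * \<delta>"
          using Suc.prems(2) k(1) P(2) by blast
        ultimately show ?thesis using k(2)[of p] by (simp add: algebra_simps)
      qed
      ultimately show ?thesis by (intro Suc.IH[of "range k"]) auto
    qed
  qed
  obtain n where "M < real n * \<delta>"
    using ex_less_of_nat_mult[OF \<open>0 < \<delta>\<close>] by blast
  then have "\<forall>k\<in>UNIV. \<nu> k UNIV \<le> real n * \<delta>"
    using bound by (meson less_imp_le order_trans)
  from step[OF infinite_UNIV_nat this] show thesis using that by auto
qed

section \<open>Order bounded series in a dual Banach lattice\<close>

text \<open>
  Order bounded series need not converge in norm, even in a dual lattice, but they converge
  pointwise, because the values on a positive vector form a series with bounded partial sums.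
  The sum over \<open>A\<close> is therefore taken pointwise.
\<close>

definition dual_sum :: "(nat \<Rightarrow> ('a::banach_lattice \<Rightarrow>\<^sub>L real)) \<Rightarrow> nat set \<Rightarrow> ('a \<Rightarrow>\<^sub>L real)"
  where "dual_sum z A = Blinfun (\<lambda>e. \<Sum>k. if k \<in> A then z k e else 0)"

context
  fixes u :: "nat \<Rightarrow> ('a::banach_lattice \<Rightarrow>\<^sub>L real)" and x :: "'a \<Rightarrow>\<^sub>L real"
  assumes sum_le: "\<And>K. (\<Sum>k<K. u k) \<le> x"
begin

lemma dual_sum_summable:
  assumes "\<And>k. \<bar>z k\<bar> \<le> u k"
  shows "summable (\<lambda>k. if k \<in> A then z k e else 0)"
    and "\<bar>\<Sum>k. if k \<in> A then z k e else 0\<bar> \<le> x \<bar>e\<bar>"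
proof -
  have bound: "\<bar>if k \<in> A then z k e else 0\<bar> \<le> u k \<bar>e\<bar>" for k
    using abs_blinfun_apply_le[of "z k" e] blinfun_leD[OF assms[of k] abs_ge_zero[of e]]
    by auto
  have nn: "0 \<le> u k \<bar>e\<bar>" for k
    using bound[of k] by (meson abs_ge_zero order_trans)
  have partial: "(\<Sum>k<K. u k \<bar>e\<bar>) \<le> x \<bar>e\<bar>" for K
    using blinfun_leD[OF sum_le[of K], of "\<bar>e\<bar>"] by (simp add: blinfun.sum_left)
  have u: "summable (\<lambda>k. u k \<bar>e\<bar>)"
    by (rule bounded_imp_summable[OF nn, where B = "x \<bar>e\<bar>"])
      (metis lessThan_Suc_atMost partial)
  have z: "summable (\<lambda>k. \<bar>if k \<in> A then z k e else 0\<bar>)"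
    by (rule summable_comparison_test'[OF u, of 0]) (use bound in simp)
  then show "summable (\<lambda>k. if k \<in> A then z k e else 0)"
    by (rule summable_rabs_cancel)
  have "\<bar>\<Sum>k. if k \<in> A then z k e else 0\<bar> \<le> (\<Sum>k. \<bar>if k \<in> A then z k e else 0\<bar>)"
    by (rule summable_rabs[OF z])
  also have "\<dots> \<le> (\<Sum>k. u k \<bar>e\<bar>)"
    by (rule suminf_le[OF bound z u])
  also have "\<dots> \<le> x \<bar>e\<bar>"
    by (rule suminf_le_const[OF u partial])
  finally show "\<bar>\<Sum>k. if k \<in> A then z k e else 0\<bar> \<le> x \<bar>e\<bar>" .
qed

lemma dual_sum_apply:
  assumes z: "\<And>k. \<bar>z k\<bar> \<le> u k"
  shows "dual_sum z A e = (\<Sum>k. if k \<in> A then z k e else 0)"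
proof -
  have "bounded_linear (\<lambda>e. \<Sum>k. if k \<in> A then z k e else 0)"
  proof (rule bounded_linear_intro[where K = "norm x"])
    fix e e' and c :: real
    show "(\<Sum>k. if k \<in> A then z k (e + e') else 0)
        = (\<Sum>k. if k \<in> A then z k e else 0) + (\<Sum>k. if k \<in> A then z k e' else 0)"
      by (subst suminf_add[OF dual_sum_summable(1)[OF z] dual_sum_summable(1)[OF z]])
        (auto intro!: suminf_cong simp: blinfun.add_right)
    show "(\<Sum>k. if k \<in> A then z k (c *\<^sub>R e) else 0) = c *\<^sub>R (\<Sum>k. if k \<in> A then z k e else 0)"
      by (simp only: real_scaleR_def, subst suminf_mult[OF dual_sum_summable(1)[OF z], symmetric])
        (auto intro!: suminf_cong simp: blinfun.scaleR_right)
    have "x \<bar>e\<bar> \<le> norm e * norm x"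
      using norm_blinfun[of x "\<bar>e\<bar>"] by (simp add: norm_abs_eq mult.commute)
    then show "norm (\<Sum>k. if k \<in> A then z k e else 0) \<le> norm e * norm x"
      using dual_sum_summable(2)[OF z, of A e] by simp
  qed
  then show ?thesis by (simp add: dual_sum_def bounded_linear_Blinfun_apply)
qed

lemma dual_sum_Un:
  assumes z: "\<And>k. \<bar>z k\<bar> \<le> u k" and "A \<inter> B = {}"
  shows "dual_sum z (A \<union> B) = dual_sum z A + dual_sum z B"
proof (rule blinfun_eqI)
  fix e
  show "dual_sum z (A \<union> B) e = (dual_sum z A + dual_sum z B) e"
    unfolding blinfun.add_left dual_sum_apply[OF z]
    by (subst suminf_add[OF dual_sum_summable(1)[OF z] dual_sum_summable(1)[OF z]])
      (use assms(2) in \<open>auto intro!: suminf_cong\<close>)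
qed

lemma dual_sum_singleton:
  assumes z: "\<And>k. \<bar>z k\<bar> \<le> u k"
  shows "dual_sum z {k} = z k"
proof (rule blinfun_eqI)
  fix e
  have "(\<Sum>i. if i \<in> {k} then z i e else 0) = (\<Sum>i\<in>{k}. if i \<in> {k} then z i e else 0)"
    by (rule suminf_finite) auto
  then show "dual_sum z {k} e = z k e"
    by (simp add: dual_sum_apply[OF z])
qed

lemma abs_dual_sum_le:
  assumes z: "\<And>k. \<bar>z k\<bar> \<le> u k"
  shows "\<bar>dual_sum z A\<bar> \<le> dual_sum u A"
proof -
  have "0 \<le> u k" for k using z[of k] by (meson abs_ge_zero order_trans)
  then have u: "\<bar>u k\<bar> \<le> u k" for k by simp
  have le: "z k \<le> u k" "- z k \<le> u k" for k
    using z[of k] by (simp_all add: abs_le_iff)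
  have "dual_sum z A \<le> dual_sum u A"
    unfolding less_eq_blinfun_def dual_sum_apply[OF z] dual_sum_apply[OF u]
    by (auto intro!: suminf_le dual_sum_summable z u blinfun_leD le)
  moreover have "- dual_sum z A \<le> dual_sum u A"
    unfolding less_eq_blinfun_def blinfun.minus_left dual_sum_apply[OF z] dual_sum_apply[OF u]
    by (subst suminf_minus[OF dual_sum_summable(1)[OF z], symmetric])
      (use blinfun_leD[OF le(2)] in
        \<open>auto intro!: suminf_le dual_sum_summable z u summable_minus simp: blinfun.minus_left\<close>)
  ultimately show ?thesis by (simp add: abs_le_iff)
qed

lemma dual_sum_le:
  assumes u: "\<And>k. 0 \<le> u k"
  shows "dual_sum u A \<le> x"
proof -
  have u': "\<bar>u k\<bar> \<le> u k" for k using u by simp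
  show ?thesis
    unfolding less_eq_blinfun_def dual_sum_apply[OF u']
    by (metis abs_le_D1 abs_of_nonneg dual_sum_summable(2)[OF u'])
qed

end

section \<open>Moduli of disjoint weak* null sequences\<close>

text \<open>
  If \<open>\<bar>\<phi> n\<bar> x\<close> does not tend to \<open>0\<close>, the pieces of \<open>x\<close> that carry a subsequence of the
  moduli can be summed over any index set.  Rosenthal's lemma finds an index set on which the sum
  of the corresponding test vectors \<open>y k\<close> is felt by the \<open>k\<close>-th functional of the subsequence
  mainly through \<open>y k\<close>, so weak* nullity fails at that sum.
\<close>

lemma weak_star_null_abs:
  fixes \<phi> :: "nat \<Rightarrow> (('a::banach_lattice \<Rightarrow>\<^sub>L real) \<Rightarrow>\<^sub>L real)"
  assumes disj: "disjoint_seq \<phi>" and null: "weak_star_null \<phi>"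
  shows "weak_star_null (\<lambda>n. \<bar>\<phi> n\<bar>)"
proof -
  have "\<exists>M. \<forall>n. \<bar>\<phi> n x\<bar> \<le> M" for x
    using null Bseq_def[of "\<lambda>n. \<phi> n x"] convergent_imp_Bseq[of "\<lambda>n. \<phi> n x"]
    unfolding weak_star_null_def convergent_def by (metis real_norm_def)
  then obtain C where C: "\<And>n. norm (\<phi> n) \<le> C"
    using pointwise_bounded_functionals_bounded by metis
  have pos: "(\<lambda>n. \<bar>\<phi> n\<bar> x) \<longlonglongrightarrow> 0" if x: "0 \<le> x" for x
  proof (rule ccontr)
    assume "\<not> ?thesis"
    then obtain \<epsilon> where \<epsilon>: "0 < \<epsilon>" "\<exists>\<^sub>F n in sequentially. \<epsilon> \<le> \<bar>\<phi> n\<bar> x"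
      using blinfun_apply_nonneg[OF abs_ge_zero x]
      by (fastforce simp: tendsto_iff not_eventually not_less)
    define I where "I = {n. \<epsilon> \<le> \<bar>\<phi> n\<bar> x}"
    have I: "infinite I" "\<And>n. n \<in> I \<Longrightarrow> \<epsilon> \<le> \<bar>\<phi> n\<bar> x"
      using \<epsilon>(2) by (simp_all add: I_def frequently_cofinite[symmetric] cofinite_eq_sequentially)
    have disj': "inf \<bar>\<phi> m\<bar> \<bar>\<phi> n\<bar> = 0" if "m \<noteq> n" for m n
      using disj that by (simp add: disjoint_seq_def)
    have M: "\<bar>\<phi> n\<bar> x \<le> C * norm x" for n
      using norm_blinfun[of "\<bar>\<phi> n\<bar>" x] mult_right_mono[OF C[of n], of "norm x"]
      by (simp add: norm_abs_eq)
    obtain r :: "nat \<Rightarrow> nat" and u where r: "strict_mono r"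
      and u: "\<And>k. 0 \<le> u k" "\<And>K. (\<Sum>k<K. u k) \<le> x"
        "\<And>k. \<epsilon> / 2 \<le> \<bar>\<phi> (r k)\<bar> (u k)"
      by (rule disjoint_functionals_pieces[of "\<lambda>n. \<bar>\<phi> n\<bar>" x \<epsilon> "C * norm x" I,
            OF abs_ge_zero disj' x \<epsilon>(1) M I]) (assumption | rule that)+
    have "\<exists>y. \<bar>y\<bar> \<le> u k \<and> \<epsilon> / 4 < \<phi> (r k) y" for k
    proof -
      obtain y where "\<bar>y\<bar> \<le> u k" "\<bar>\<phi> (r k)\<bar> (u k) - \<epsilon> / 4 < \<phi> (r k) y"
        using abs_blinfun_approx[OF u(1), of "\<epsilon> / 4"] \<epsilon>(1) by (metis zero_less_divide_iff zero_less_numeral)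
      then show ?thesis using u(3)[of k] by (intro exI[of _ y]) auto
    qed
    then obtain y where y: "\<And>k. \<bar>y k\<bar> \<le> u k" "\<And>k. \<epsilon> / 4 < \<phi> (r k) (y k)" by metis
    have u': "\<bar>u k\<bar> \<le> u k" for k using u(1) by simp
    \<comment> \<open>The diagonal term exceeds \<open>\<epsilon> / 4\<close>; an off-diagonal error below \<open>\<epsilon> / 8\<close> cannot cancel it.\<close>
    define \<nu> where "\<nu> k A = \<bar>\<phi> (r k)\<bar> (dual_sum u A)" for k A
    obtain A where A: "infinite A" "\<And>k. k \<in> A \<Longrightarrow> \<nu> k (A - {k}) < \<epsilon> / 8"
    proof (rule rosenthal_lemma[of \<nu> "C * norm x" "\<epsilon> / 8"])
      show "0 \<le> \<nu> k A" for k A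
        unfolding \<nu>_def using abs_dual_sum_le[OF u(2) u', of A]
        by (intro blinfun_apply_nonneg) (auto intro: order_trans[OF abs_ge_zero])
      show "\<nu> k (A \<union> B) = \<nu> k A + \<nu> k B" if "A \<inter> B = {}" for k A B
        unfolding \<nu>_def by (simp add: dual_sum_Un[OF u(2) u' that] blinfun.add_right)
      show "\<nu> k UNIV \<le> C * norm x" for k
        unfolding \<nu>_def
        using blinfun_apply_mono[OF _ dual_sum_le[OF u(2) u(1)], of "\<bar>\<phi> (r k)\<bar>" UNIV] M[of "r k"] by simp
    qed (use \<epsilon>(1) in auto)
    have big: "\<epsilon> / 8 < \<phi> (r k) (dual_sum y A)" if "k \<in> A" for k
    proof -
      have "dual_sum y A = y k + dual_sum y (A - {k})"
        using dual_sum_Un[OF u(2) y(1), of "{k}" "A - {k}"] that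
        by (simp add: dual_sum_singleton[OF u(2) y(1)] insert_absorb)
      moreover have "\<bar>\<phi> (r k) (dual_sum y (A - {k}))\<bar> \<le> \<nu> k (A - {k})"
        unfolding \<nu>_def
        using abs_blinfun_apply_le[of "\<phi> (r k)" "dual_sum y (A - {k})"]
          blinfun_apply_mono[OF _ abs_dual_sum_le[OF u(2) y(1)], of "\<bar>\<phi> (r k)\<bar>" "A - {k}"]
        by simp
      ultimately show ?thesis
        using A(2)[OF that] y(2)[of k] by (simp add: blinfun.add_right)
    qed
    have "(\<lambda>k. \<phi> (r k) (dual_sum y A)) \<longlonglongrightarrow> 0"
      using LIMSEQ_subseq_LIMSEQ[OF _ r, of "\<lambda>n. \<phi> n (dual_sum y A)" 0] null
      by (simp add: weak_star_null_def o_def)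
    then have "\<forall>\<^sub>F k in sequentially. \<phi> (r k) (dual_sum y A) < \<epsilon> / 8"
      using \<epsilon>(1) by (intro order_tendstoD) auto
    then obtain k0 where "\<forall>k\<ge>k0. \<phi> (r k) (dual_sum y A) < \<epsilon> / 8"
      by (auto simp: eventually_sequentially)
    moreover obtain k where "k \<in> A" "k0 \<le> k"
      using A(1) by (meson infinite_nat_iff_unbounded_le)
    ultimately show False using big[of k] by fastforce
  qed
  show ?thesis
    unfolding weak_star_null_def
  proof
    fix x
    have "\<bar>\<phi> n\<bar> x = \<bar>\<phi> n\<bar> (pprt x) - \<bar>\<phi> n\<bar> (pprt (- x))" for n
      by (simp add: blinfun.diff_right[symmetric] pprt_minus_pprt)
    then show "(\<lambda>n. \<bar>\<phi> n\<bar> x) \<longlonglongrightarrow> 0"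
      using tendsto_diff[OF pos[of "pprt x"] pos[of "pprt (- x)"]] by simp
  qed
qed

section \<open>Biadjoints of regular operators\<close>

lemma biadjoint_apply:
  fixes T :: "'a::real_normed_vector \<Rightarrow>\<^sub>L 'b::real_normed_vector"
  shows "dual_adjoint (dual_adjoint T) \<phi> g = \<phi> (g o\<^sub>L T)"
  by (simp add: dual_adjoint_apply)

text \<open>
  The biadjoint of a positive operator is positive and weak* continuous, so it turns the
  weak* null moduli \<open>\<bar>\<phi> n\<bar>\<close> into a positive weak* null sequence that dominates the images of the
  \<open>\<phi> n\<close>; to this sequence the dual positive Schur property applies.
\<close>

lemma positive_biadjoint_null:
  fixes P :: "'e::banach_lattice \<Rightarrow>\<^sub>L 'f::banach_lattice"
  assumes schur: "dual_positive_schur TYPE('f \<Rightarrow>\<^sub>L real)"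
    and P: "\<And>x. 0 \<le> x \<Longrightarrow> 0 \<le> P x"
    and \<phi>: "disjoint_seq \<phi>" "weak_star_null \<phi>"
  shows "(\<lambda>n. dual_adjoint (dual_adjoint P) (\<phi> n)) \<longlonglongrightarrow> 0"
proof -
  let ?B = "dual_adjoint (dual_adjoint P)"
  have B: "?B \<theta> \<le> ?B \<psi>" if "\<theta> \<le> \<psi>" for \<theta> \<psi>
    unfolding less_eq_blinfun_def[of "?B \<theta>"]
  proof (intro allI impI)
    fix g :: "'f \<Rightarrow>\<^sub>L real" assume "0 \<le> g"
    then have "0 \<le> g o\<^sub>L P"
      using P by (simp add: less_eq_blinfun_def[of 0 "g o\<^sub>L P"] blinfun_apply_nonneg)
    then show "?B \<theta> g \<le> ?B \<psi> g"
      unfolding biadjoint_apply by (rule blinfun_leD[OF that])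
  qed
  have "0 \<le> ?B \<bar>\<phi> n\<bar>" for n
    using B[OF abs_ge_zero[of "\<phi> n"]] by (simp add: blinfun.zero_right)
  moreover have "weak_star_null (\<lambda>n. ?B \<bar>\<phi> n\<bar>)"
    using weak_star_null_abs[OF \<phi>] by (simp add: weak_star_null_def biadjoint_apply)
  ultimately have lim: "(\<lambda>n. ?B \<bar>\<phi> n\<bar>) \<longlonglongrightarrow> 0"
    by (intro schur[unfolded dual_positive_schur_def, rule_format] conjI allI)
  have "\<bar>?B (\<phi> n)\<bar> \<le> \<bar>?B \<bar>\<phi> n\<bar>\<bar>" for n
  proof -
    have "\<bar>?B (\<phi> n)\<bar> \<le> ?B \<bar>\<phi> n\<bar>"
      using B[OF abs_ge_self[of "\<phi> n"]] B[OF abs_ge_minus_self[of "\<phi> n"]]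
      by (simp add: abs_le_iff blinfun.minus_right)
    then show ?thesis using abs_ge_self order_trans by blast
  qed
  then have "norm (?B (\<phi> n)) \<le> norm (?B \<bar>\<phi> n\<bar>)" for n
    by (rule norm_mono_abs)
  then show ?thesis
    by (intro tendsto_norm_zero_cancel[OF tendsto_sandwich[OF _ _ tendsto_const tendsto_norm_zero[OF lim]]])
      auto
qed

lemma regular_biadjoint_null:
  fixes T :: "'e::banach_lattice \<Rightarrow> 'f::banach_lattice"
  assumes schur: "dual_positive_schur TYPE('f \<Rightarrow>\<^sub>L real)" and T: "regular_operator T"
    and \<phi>: "disjoint_seq \<phi>" "weak_star_null \<phi>"
  shows "(\<lambda>n. dual_adjoint (dual_adjoint (Blinfun T)) (\<phi> n)) \<longlonglongrightarrow> 0"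
proof -
  obtain P Q where PQ: "positive_operator P" "positive_operator Q" "T = (\<lambda>x. P x - Q x)"
    using T unfolding regular_operator_def by blast
  have app: "Blinfun P x = P x" "Blinfun Q x = Q x" for x
    using PQ by (simp_all add: bounded_linear_Blinfun_apply positive_operator_bounded)
  have "Blinfun T = Blinfun P - Blinfun Q"
    using Blinfun_regular_apply[OF T] by (intro blinfun_eqI) (simp add: PQ(3) app blinfun.diff_left)
  then have "g o\<^sub>L Blinfun T = (g o\<^sub>L Blinfun P) - (g o\<^sub>L Blinfun Q)" for g :: "'f \<Rightarrow>\<^sub>L real"
    by (auto intro!: blinfun_eqI simp: blinfun.diff_left blinfun.diff_right)
  then have eq: "dual_adjoint (dual_adjoint (Blinfun T)) \<psi>
      = dual_adjoint (dual_adjoint (Blinfun P)) \<psi> - dual_adjoint (dual_adjoint (Blinfun Q)) \<psi>" for \<psi>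
    by (intro blinfun_eqI) (simp add: biadjoint_apply blinfun.diff_left blinfun.diff_right)
  have "(\<lambda>n. dual_adjoint (dual_adjoint (Blinfun P)) (\<phi> n)) \<longlonglongrightarrow> 0"
       "(\<lambda>n. dual_adjoint (dual_adjoint (Blinfun Q)) (\<phi> n)) \<longlonglongrightarrow> 0"
    using PQ(1,2) by (auto intro!: positive_biadjoint_null[OF schur _ \<phi>] simp: app positive_operator_def)
  from tendsto_diff[OF this] show ?thesis by (simp add: eq)
qed

lemma weakly_null_imp_weak_star_null:
  fixes \<phi> :: "nat \<Rightarrow> ('a::real_normed_vector \<Rightarrow>\<^sub>L real)"
  assumes "weakly_null \<phi>"
  shows "weak_star_null \<phi>"
  unfolding weak_star_null_def
proof
  fix x
  show "(\<lambda>n. \<phi> n x) \<longlonglongrightarrow> 0"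
    using assms[unfolded weakly_null_def, rule_format, of "Blinfun (\<lambda>f. blinfun_apply f x)"]
    by (simp add: bounded_linear_Blinfun_apply blinfun.bounded_linear_left)
qed

theorem corollary4p7:
  fixes T :: "'e::banach_lattice \<Rightarrow> 'f::banach_lattice"
  assumes "dual_positive_schur TYPE('f \<Rightarrow>\<^sub>L real)"
    and "regular_operator T"
  shows "almost_limited (dual_adjoint (Blinfun T)) \<and>
    almost_dunford_pettis (dual_adjoint (dual_adjoint (Blinfun T)))"
  using regular_biadjoint_null[OF assms] weakly_null_imp_weak_star_null
  unfolding almost_limited_def almost_dunford_pettis_def by blast

end
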